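(* Let $A$ be a commutative ring, let $T$ be a weakly divisible archimedean semiring of $A$, and let $a\in A$. Suppose that $\varphi(a)\ge 0$ for all $\varphi\in S(T)$, and that there is an identity $a=b_1t_1+\dots+b_mt_m$ with $m\in\mathbb{N}$, $b_1,\dots,b_m\in A$ and $t_1,\dots,t_m\in T$ such that $\varphi(b_i)>0$ for all $\varphi\in S_{a=0}(T)$ and all $i\in\{1,\dots,m\}$. Then $a\in T$.
   Context: All rings have a unity and ring homomorphisms preserve unities. Let $A$ be a commutative ring (the unique ring homomorphism $\mathbb{Z}\to A$ is not required to be injective). A set $T\subset A$ is called a semiring of $A$ if $0,1\in T$, $T+T\subset T$ and $TT\subset T$. A semiring $T$ of $A$ is called archimedean if $\mathbb{Z}+T=A$, i.e. every element of $A$ is the sum of (the image of) an integer and an element of $T$. A semiring $T$ of $A$ is called weakly divisible if there is some integer $r\ge 2$ such that $r=r\cdot 1$ is a unit of $A$ and $\frac1r\in T$. For a semiring $T$ of $A$, $S(T)$ denotes the set of all ring homomorphisms $\varphi:A\to\mathbb{R}$ with $\varphi(T)\subset[0,\infty)$, and for $a\in A$, $S_{a=0}(T):=\{\varphi\in S(T)\mid\varphi(a)=0\}$. *)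

theory Defs
  imports "HOL-Algebra.Algebraic_Closure_Type"
begin

text \<open>
  Rings are \<^locale>\<open>cring\<close>s, so the zero ring is included (the type class
  \<^class>\<open>comm_ring_1\<close> would exclude it).
  The term \<open>[k] \<cdot>\<^bsub>A\<^esub> \<one>\<^bsub>A\<^esub>\<close> with \<open>k :: int\<close> is the image of \<open>k\<close> under the unique ring
  homomorphism from the integers to \<open>A\<close>.
\<close>

definition semiring_of :: "('a, 'm) ring_scheme \<Rightarrow> 'a set \<Rightarrow> bool" where
  "semiring_of A T \<longleftrightarrow>
     T \<subseteq> carrier A \<and> \<zero>\<^bsub>A\<^esub> \<in> T \<and> \<one>\<^bsub>A\<^esub> \<in> T \<and>
     (\<forall>s\<in>T. \<forall>t\<in>T. s \<oplus>\<^bsub>A\<^esub> t \<in> T) \<and>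
     (\<forall>s\<in>T. \<forall>t\<in>T. s \<otimes>\<^bsub>A\<^esub> t \<in> T)"

definition archimedean :: "('a, 'm) ring_scheme \<Rightarrow> 'a set \<Rightarrow> bool" where
  "archimedean A T \<longleftrightarrow>
     (\<forall>x\<in>carrier A. \<exists>k::int. \<exists>t\<in>T. x = ([k] \<cdot>\<^bsub>A\<^esub> \<one>\<^bsub>A\<^esub>) \<oplus>\<^bsub>A\<^esub> t)"

definition weakly_divisible :: "('a, 'm) ring_scheme \<Rightarrow> 'a set \<Rightarrow> bool" where
  "weakly_divisible A T \<longleftrightarrow>
     (\<exists>r::int. r \<ge> 2 \<and> [r] \<cdot>\<^bsub>A\<^esub> \<one>\<^bsub>A\<^esub> \<in> Units A \<and> inv\<^bsub>A\<^esub> ([r] \<cdot>\<^bsub>A\<^esub> \<one>\<^bsub>A\<^esub>) \<in> T)"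

text \<open>
  Elements of \<^const>\<open>ring_hom\<close> are total functions on the type, unconstrained outside
  the carrier; all uses below evaluate them on the carrier only.
\<close>

definition real_homs :: "('a, 'm) ring_scheme \<Rightarrow> 'a set \<Rightarrow> ('a \<Rightarrow> real) set" where
  "real_homs A T =
     {\<phi> \<in> ring_hom A (ring_of_type_algebra :: real ring). \<phi> ` T \<subseteq> {0..}}"

definition real_homs_zero ::
    "('a, 'm) ring_scheme \<Rightarrow> 'a set \<Rightarrow> 'a \<Rightarrow> ('a \<Rightarrow> real) set" where
  "real_homs_zero A T a = {\<phi> \<in> real_homs A T. \<phi> a = 0}"

lemma real_homs_iff:
  "\<phi> \<in> real_homs A T \<longleftrightarrow>
     (\<forall>x\<in>carrier A. \<forall>y\<in>carrier A. \<phi> (x \<oplus>\<^bsub>A\<^esub> y) = \<phi> x + \<phi> y) \<and>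
     (\<forall>x\<in>carrier A. \<forall>y\<in>carrier A. \<phi> (x \<otimes>\<^bsub>A\<^esub> y) = \<phi> x * \<phi> y) \<and>
     \<phi> \<one>\<^bsub>A\<^esub> = 1 \<and> (\<forall>t\<in>T. \<phi> t \<ge> 0)"
  by (auto simp: real_homs_def ring_hom_def ring_of_type_algebra_def)

end

theory Submission
  imports Defs
begin

text \<open>
  Write \<open>x \<le> y\<close> for \<open>y - x \<in> T\<close>, and let \<open>r \<ge> 2\<close> be an integer with \<open>1 / r \<in> T\<close>.
  Two ingredients are combined.

  The first is a representation principle, in the spirit of the Kadison--Dubois theorem
  (\<open>T_module_separation\<close>): a \<open>T\<close>-module \<open>M \<supseteq> T\<close> with \<open>-1 \<notin> M\<close> is nonnegative under some
  \<open>\<phi> \<in> S(T)\<close>. Enlarge \<open>M\<close> to a maximal such module by Zorn's lemma. Maximality and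
  archimedeanity force \<open>M \<union> -M = A\<close>, so that every element is comparable with every rational;
  the resulting Dedekind cut is \<open>\<phi>\<close>. It is multiplicative because \<open>T M \<subseteq> M\<close>: if \<open>x\<close> lies in a
  small rational interval, then \<open>x t\<close> lies in that interval scaled by \<open>t\<close>.

  The second is a purely algebraic descent (\<open>descent\<close>): if \<open>s, u \<in> T\<close>, \<open>b s \<ge> u\<close> and
  \<open>b \<ge> - d u\<close> for some integer \<open>d\<close>, then \<open>K b \<ge> u\<close> for a power \<open>K\<close> of \<open>r\<close>. Weak divisibility
  enters here, as it allows powers of \<open>r\<close> to be cancelled.

  Together they give the strict case: if \<open>\<phi>(b) > 0\<close> on all of \<open>S(T)\<close>, separation shows that
  \<open>-1 \<in> T - b T\<close>, that is \<open>b s \<ge> 1\<close> for some \<open>s \<in> T\<close>, and descent yields \<open>b \<in> T\<close>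
  (\<open>positive_imp_mem\<close>).

  For the theorem itself, the value \<open>\<phi>(b\<^sub>i)\<close> is known to be positive only where \<open>\<phi>(a) = 0\<close>, but
  \<open>b\<^sub>i + n a\<close> is strictly positive on all of \<open>S(T)\<close> for large \<open>n\<close>. In place of a compactness argument, this is obtained by separating a suitable module
  (\<open>positive_after_adding_multiple\<close>). Multiplying the resulting estimates by \<open>t\<^sub>i\<close> and adding up
  gives \<open>a g \<ge> u\<close>, where \<open>u = t\<^sub>1 + \<dots> + t\<^sub>m\<close> and \<open>g \<in> T\<close>, while lower bounds for the \<open>b\<^sub>i\<close> give
  \<open>a \<ge> - d u\<close> (\<open>sum_estimates\<close>). Descent, now relative to \<open>u\<close> instead of \<open>1\<close>, gives
  \<open>K a \<ge> u \<ge> 0\<close>, hence \<open>a \<in> T\<close>.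
\<close>

section \<open>Archimedean semirings\<close>

text \<open>
  The real numbers attached to ring elements below are known only up to a bounded error after
  scaling by \<open>q\<close>; since \<open>q\<close> is arbitrary, this determines them.
\<close>

lemma real_eqI_of_bounded_multiples:
  fixes x y C :: real
  assumes "\<And>q::int. (0::int) < q \<Longrightarrow> \<bar>q * x - q * y\<bar> \<le> C"
  shows "x = y"
proof (rule ccontr)
  assume "x \<noteq> y"
  then have pos: "\<bar>x - y\<bar> > 0" by simp
  obtain q :: nat where q: "C < real q * \<bar>x - y\<bar>"
    using reals_Archimedean3[OF pos] by blast
  have "C < real (Suc q) * \<bar>x - y\<bar>"
    by (rule less_le_trans[OF q]) (use pos in \<open>simp add: mult_right_mono\<close>)
  moreover have "\<bar>real (Suc q) * x - real (Suc q) * y\<bar> = real (Suc q) * \<bar>x - y\<bar>"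
    by (simp only: right_diff_distrib[symmetric] abs_mult abs_of_nat)
  ultimately show False
    using assms[of "int (Suc q)"] by simp
qed

locale archimedean_semiring = cring A for A (structure) +
  fixes T
  assumes semiring: "semiring_of A T"
    and arch: "archimedean A T"
begin

text \<open>
  Rational scalars are avoided by clearing denominators, so that this canonical image of the
  integers, which need not be injective, provides all scalars.
\<close>

definition \<iota> :: "int \<Rightarrow> 'a" where "\<iota> k = [k] \<cdot> \<one>"

lemma iota_closed [simp, intro]: "\<iota> k \<in> carrier A"
  by (simp add: \<iota>_def)

lemma iota_0 [simp]: "\<iota> 0 = \<zero>"
  by (simp add: \<iota>_def add_pow_def int_pow_def nat_pow_def)

lemma iota_1 [simp]: "\<iota> 1 = \<one>"
  by (simp add: \<iota>_def)

lemma iota_add: "\<iota> (j + k) = \<iota> j \<oplus> \<iota> k"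
  by (simp add: \<iota>_def add.int_pow_mult)

lemma iota_minus: "\<iota> (- k) = \<ominus> \<iota> k"
  by (simp add: \<iota>_def add.int_pow_neg)

lemma iota_diff: "\<iota> (j - k) = \<iota> j \<ominus> \<iota> k"
  using iota_add[of j "- k"] by (simp add: iota_minus a_minus_def)

lemma iota_mult: "\<iota> (j * k) = \<iota> j \<otimes> \<iota> k"
proof -
  have "\<iota> j \<otimes> \<iota> k = [j] \<cdot> \<iota> k"
    by (simp add: \<iota>_def add_pow_ldistr_int)
  also have "\<dots> = \<iota> (j * k)"
    by (simp add: \<iota>_def add.int_pow_pow mult.commute)
  finally show ?thesis ..
qed

lemma T_closed: "t \<in> T \<Longrightarrow> t \<in> carrier A"
  and T_zero [simp]: "\<zero> \<in> T"
  and T_one [simp]: "\<one> \<in> T"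
  and T_add: "s \<in> T \<Longrightarrow> t \<in> T \<Longrightarrow> s \<oplus> t \<in> T"
  and T_mult: "s \<in> T \<Longrightarrow> t \<in> T \<Longrightarrow> s \<otimes> t \<in> T"
  using semiring by (auto simp: semiring_of_def)

lemma T_iota: "0 \<le> k \<Longrightarrow> \<iota> k \<in> T"
  by (induction k rule: int_ge_induct) (auto simp: iota_add T_add)

lemma obtain_integer_bound:
  assumes "x \<in> carrier A"
  obtains n where "0 \<le> n" "\<iota> n \<oplus> x \<in> T"
proof -
  from arch assms obtain k t where t: "t \<in> T" and x: "x = \<iota> k \<oplus> t"
    by (auto simp: archimedean_def \<iota>_def)
  have "\<iota> \<bar>k\<bar> \<oplus> x = \<iota> (\<bar>k\<bar> + k) \<oplus> t"
    using t T_closed by (simp add: x iota_add a_assoc)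
  moreover have "\<iota> (\<bar>k\<bar> + k) \<in> T"
    by (rule T_iota) arith
  ultimately have "\<iota> \<bar>k\<bar> \<oplus> x \<in> T"
    using t T_add by simp
  then show thesis using that[of "\<bar>k\<bar>"] by simp
qed

lemma hom_rules:
  assumes "\<phi> \<in> real_homs A T"
  shows "\<phi> \<one> = 1" and "x \<in> carrier A \<Longrightarrow> \<phi> (\<ominus> x) = - \<phi> x" and "\<phi> (\<iota> k) = k"
    and "x \<in> carrier A \<Longrightarrow> y \<in> carrier A \<Longrightarrow> \<phi> (x \<oplus> y) = \<phi> x + \<phi> y"
    and "x \<in> carrier A \<Longrightarrow> y \<in> carrier A \<Longrightarrow> \<phi> (x \<otimes> y) = \<phi> x * \<phi> y"
proof -
  note [simp] = assms[unfolded real_homs_iff]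
  show "\<phi> \<one> = 1" by simp
  show add: "x \<in> carrier A \<Longrightarrow> y \<in> carrier A \<Longrightarrow> \<phi> (x \<oplus> y) = \<phi> x + \<phi> y" for x y by simp
  show "x \<in> carrier A \<Longrightarrow> y \<in> carrier A \<Longrightarrow> \<phi> (x \<otimes> y) = \<phi> x * \<phi> y" by simp
  have zero: "\<phi> \<zero> = 0" using add[of \<zero> \<zero>] by simp
  show neg: "x \<in> carrier A \<Longrightarrow> \<phi> (\<ominus> x) = - \<phi> x" for x
    using add[of x "\<ominus> x"] zero by (simp add: r_neg)
  have nonneg: "\<phi> (\<iota> k) = k" if "0 \<le> k" for k
    using that by (induction k rule: int_ge_induct) (simp_all add: zero iota_add)
  show "\<phi> (\<iota> k) = k"
    using nonneg[of k] nonneg[of "- k"] neg[of "\<iota> k"] by (cases "0 \<le> k") (auto simp: iota_minus)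
qed

section \<open>Separation of modules over the semiring\<close>

text \<open>
  Requiring \<open>T \<subseteq> M\<close> amounts to \<open>1 \<in> M\<close>; it makes \<open>- 1 \<in> M\<close> the obstruction to
  nonnegativity under a homomorphism.
\<close>

definition T_module :: "'a set \<Rightarrow> bool" where
  "T_module M \<longleftrightarrow> T \<subseteq> M \<and> M \<subseteq> carrier A \<and>
     (\<forall>x\<in>M. \<forall>y\<in>M. x \<oplus> y \<in> M) \<and> (\<forall>t\<in>T. \<forall>x\<in>M. t \<otimes> x \<in> M)"

lemma T_moduleD:
  assumes "T_module M"
  shows "x \<in> M \<Longrightarrow> x \<in> carrier A" "t \<in> T \<Longrightarrow> t \<in> M"
    "x \<in> M \<Longrightarrow> y \<in> M \<Longrightarrow> x \<oplus> y \<in> M" "t \<in> T \<Longrightarrow> x \<in> M \<Longrightarrow> t \<otimes> x \<in> M"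
  using assms by (auto simp: T_module_def)

lemma T_module_adjoin:
  assumes M: "T_module M" and x: "x \<in> carrier A"
  shows "T_module {m \<oplus> t \<otimes> x | m t. m \<in> M \<and> t \<in> T}" (is "T_module ?N")
    and "M \<subseteq> {m \<oplus> t \<otimes> x | m t. m \<in> M \<and> t \<in> T}"
    and "x \<in> {m \<oplus> t \<otimes> x | m t. m \<in> M \<and> t \<in> T}"
proof -
  note MD = T_moduleD[OF M]
  show sub: "M \<subseteq> ?N"
  proof
    fix m assume "m \<in> M"
    moreover from this have "m = m \<oplus> \<zero> \<otimes> x"
      using x MD by simp
    ultimately show "m \<in> ?N" using T_zero by blast
  qed
  have "x = \<zero> \<oplus> \<one> \<otimes> x" using x by simp
  then show "x \<in> ?N" using MD(2) T_zero T_one by blast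
  show "T_module ?N"
    unfolding T_module_def
  proof (intro conjI ballI)
    show "T \<subseteq> ?N" using sub MD(2) by blast
    show "?N \<subseteq> carrier A" using MD T_closed x by auto
  next
    fix y z assume "y \<in> ?N" "z \<in> ?N"
    then obtain m t m' t' where *: "m \<in> M" "t \<in> T" "y = m \<oplus> t \<otimes> x"
      "m' \<in> M" "t' \<in> T" "z = m' \<oplus> t' \<otimes> x" by blast
    have "y \<oplus> z = (m \<oplus> m') \<oplus> (t \<oplus> t') \<otimes> x"
      using MD(1)[OF *(1)] MD(1)[OF *(4)] T_closed[OF *(2)] T_closed[OF *(5)] x
      unfolding * by algebra
    then show "y \<oplus> z \<in> ?N" using * MD(3) T_add by blast
  next
    fix s y assume s: "s \<in> T" and "y \<in> ?N"
    then obtain m t where *: "m \<in> M" "t \<in> T" "y = m \<oplus> t \<otimes> x" by blast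
    have "s \<otimes> y = s \<otimes> m \<oplus> (s \<otimes> t) \<otimes> x"
      using MD(1)[OF *(1)] T_closed[OF *(2)] T_closed[OF s] x unfolding * by algebra
    then show "s \<otimes> y \<in> ?N" using * s MD(4) T_mult by blast
  qed
qed

text \<open>
  If neither \<open>x\<close> nor \<open>- x\<close> lies in \<open>M\<close>, adjoining either one produces \<open>- 1\<close>. Eliminating \<open>x\<close>
  between the two representations of \<open>- 1\<close> only shows that \<open>- t \<in> M\<close> for the coefficient \<open>t \<in> T\<close>
  of \<open>x\<close>. It is the archimedean property that makes this contradictory: \<open>x\<close> is bounded below by
  an integer, so \<open>t x \<in> M\<close> as well and \<open>- 1\<close> was already in \<open>M\<close>.
\<close>

lemma maximal_T_module_total:
  assumes M: "T_module M" and proper: "\<ominus> \<one> \<notin> M"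
    and max: "\<And>N. T_module N \<Longrightarrow> \<ominus> \<one> \<notin> N \<Longrightarrow> M \<subseteq> N \<Longrightarrow> N = M"
    and x: "x \<in> carrier A"
  shows "x \<in> M \<or> \<ominus> x \<in> M"
proof (rule ccontr)
  assume *: "\<not> ?thesis"
  note MD = T_moduleD[OF M]
  have escape: "\<exists>m\<in>M. \<exists>t\<in>T. \<ominus> \<one> = m \<oplus> t \<otimes> y" if "y \<in> carrier A" "y \<notin> M" for y
    using max[OF T_module_adjoin(1)[OF M that(1)]] T_module_adjoin(2,3)[OF M that(1)] that(2)
    by blast
  obtain m t where m: "m \<in> M" and t: "t \<in> T" and mt: "\<ominus> \<one> = m \<oplus> t \<otimes> x"
    using escape[OF x] * by blast
  obtain m' t' where m': "m' \<in> M" and t': "t' \<in> T" and mt': "\<ominus> \<one> = m' \<oplus> t' \<otimes> (\<ominus> x)"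
    using escape[of "\<ominus> x"] x * by auto
  note c = MD(1)[OF m] MD(1)[OF m'] T_closed[OF t] T_closed[OF t'] x
  have "t' \<otimes> m \<oplus> t \<otimes> m' \<oplus> t' = t' \<otimes> (m \<oplus> t \<otimes> x) \<oplus> t \<otimes> (m' \<oplus> t' \<otimes> (\<ominus> x)) \<oplus> t'"
    using c by algebra
  also have "\<dots> = \<ominus> t"
    unfolding mt[symmetric] mt'[symmetric] using c by algebra
  finally have neg_t: "\<ominus> t \<in> M"
    using MD t t' m m' by metis
  obtain n where n: "0 \<le> n" and "\<iota> n \<oplus> x \<in> T"
    using obtain_integer_bound[OF x] .
  then have 1: "t \<otimes> (\<iota> n \<oplus> x) \<in> M"
    using t T_mult MD(2) by blast
  have 2: "\<iota> n \<otimes> (\<ominus> t) \<in> M"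
    using n neg_t MD(4) T_iota by blast
  have "\<ominus> \<one> = m \<oplus> (t \<otimes> (\<iota> n \<oplus> x) \<oplus> \<iota> n \<otimes> (\<ominus> t))"
    unfolding mt using c iota_closed[of n] by algebra
  then show False
    using 1 2 m MD(3) proper by metis
qed

text \<open>
  Totality makes \<open>M\<close> the nonnegative cone of a total preorder on \<open>A\<close>, and each element is
  located by its rational lower bounds, whose supremum is the value of \<open>\<phi>\<close>. For each \<open>q > 0\<close> there
  is an integer \<open>k\<close> with \<open>k \<le> q x \<le> k + 1\<close>, both in the preorder and after applying \<open>\<phi>\<close>; adding
  such brackets gives additivity, and multiplying one by \<open>t \<in> T\<close> gives
  \<open>\<phi>(x t) = \<phi>(x) \<phi>(t)\<close>. Since every element is an integer plus an element of \<open>T\<close>, multiplicativity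
  follows in general.
\<close>

lemma total_T_module_hom:
  assumes M: "T_module M" and proper: "\<ominus> \<one> \<notin> M"
    and total: "\<And>x. x \<in> carrier A \<Longrightarrow> x \<in> M \<or> \<ominus> x \<in> M"
  shows "\<exists>\<phi>\<in>real_homs A T. \<forall>x\<in>M. \<phi> x \<ge> 0"
proof -
  note MD = T_moduleD[OF M]
  have iota_M: "0 \<le> k" if "\<iota> k \<in> M" for k
  proof (rule ccontr)
    assume "\<not> 0 \<le> k"
    then have "\<iota> (- 1 - k) \<in> M" by (intro MD(2) T_iota) simp
    then have "\<iota> k \<oplus> \<iota> (- 1 - k) \<in> M" using that MD(3) by blast
    moreover have "\<iota> k \<oplus> \<iota> (- 1 - k) = \<ominus> \<one>"
      by (simp flip: iota_add) (simp add: iota_minus)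
    ultimately show False using proper by simp
  qed
  have cmp: "k * q' \<le> k' * q"
    if "x \<in> carrier A" "q > 0" "q' > 0" "\<iota> q \<otimes> x \<ominus> \<iota> k \<in> M" "\<iota> k' \<ominus> \<iota> q' \<otimes> x \<in> M"
    for x q q' k k'
  proof -
    have "\<iota> q' \<otimes> (\<iota> q \<otimes> x \<ominus> \<iota> k) \<oplus> \<iota> q \<otimes> (\<iota> k' \<ominus> \<iota> q' \<otimes> x) \<in> M"
      using that by (intro MD(3) MD(4) T_iota) auto
    moreover have "\<iota> q' \<otimes> (\<iota> q \<otimes> x \<ominus> \<iota> k) \<oplus> \<iota> q \<otimes> (\<iota> k' \<ominus> \<iota> q' \<otimes> x) = \<iota> (k' * q - k * q')"
      unfolding iota_diff iota_mult
      using that(1) iota_closed[of q] iota_closed[of q'] iota_closed[of k] iota_closed[of k']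
      by algebra
    ultimately show ?thesis using iota_M by fastforce
  qed
  have bracket: "\<exists>k. x \<ominus> \<iota> k \<in> M \<and> \<iota> (k + 1) \<ominus> x \<in> M" if x: "x \<in> carrier A" for x
  proof (rule ccontr)
    assume none: "\<not> ?thesis"
    \<comment> \<open>Then every integer above a lower bound of \<open>x\<close> is itself a lower bound, even one beyond
      an upper bound of \<open>x\<close>.\<close>
    obtain n where n: "\<iota> n \<oplus> x \<in> T" using obtain_integer_bound[OF x] .
    obtain n' where n': "\<iota> n' \<oplus> \<ominus> x \<in> T" using obtain_integer_bound[of "\<ominus> x"] x by auto
    have "x \<ominus> \<iota> k \<in> M" if "- n \<le> k" for k
      using that
    proof (induction k rule: int_ge_induct)
      case base
      then show ?case using MD(2)[OF n] x
        by (simp add: iota_minus a_minus_def a_comm)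
    next
      case (step k)
      then have "\<iota> (k + 1) \<ominus> x \<notin> M" using none by blast
      moreover have "\<ominus> (\<iota> (k + 1) \<ominus> x) = x \<ominus> \<iota> (k + 1)"
        using x iota_closed[of "k + 1"] by algebra
      ultimately show ?case
        using total[of "\<iota> (k + 1) \<ominus> x"] x by auto
    qed
    from this[of "max (- n) (n' + 1)"] have "x \<ominus> \<iota> (max (- n) (n' + 1)) \<in> M" by simp
    then have "\<iota> 1 \<otimes> x \<ominus> \<iota> (max (- n) (n' + 1)) \<in> M" "\<iota> n' \<ominus> \<iota> 1 \<otimes> x \<in> M"
      using x MD(2)[OF n'] by (simp_all add: a_minus_def)
    from cmp[OF x _ _ this] show False by simp
  qed

  define L where "L x = {real_of_int k / real_of_int q | k q. q > 0 \<and> \<iota> q \<otimes> x \<ominus> \<iota> k \<in> M}" for x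
  define \<phi> where "\<phi> x = Sup (L x)" for x
  have L_bound: "z \<le> real_of_int k' / real_of_int q'"
    if "x \<in> carrier A" "q' > 0" "\<iota> k' \<ominus> \<iota> q' \<otimes> x \<in> M" and z: "z \<in> L x" for x k' q' z
  proof -
    obtain k q where kq: "q > 0" "\<iota> q \<otimes> x \<ominus> \<iota> k \<in> M" "z = real_of_int k / real_of_int q"
      using z unfolding L_def by blast
    have "real_of_int k * real_of_int q' \<le> real_of_int k' * real_of_int q"
      using cmp[OF that(1) kq(1) that(2) kq(2) that(3)] by (simp flip: of_int_mult)
    then show ?thesis using kq(1) that(2) by (simp add: kq(3) divide_le_eq pos_le_divide_eq ac_simps)
  qed
  have upper: "q * \<phi> x \<le> k" if x: "x \<in> carrier A" "q > 0" "\<iota> k \<ominus> \<iota> q \<otimes> x \<in> M" for x k q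
  proof -
    obtain j where "x \<ominus> \<iota> j \<in> M" using bracket x(1) by blast
    then have "real_of_int j / real_of_int 1 \<in> L x"
      unfolding L_def using x(1) by (intro CollectI exI[of _ j] exI[of _ "1::int"]) simp
    then have "\<phi> x \<le> real_of_int k / real_of_int q"
      unfolding \<phi>_def using L_bound[OF x] by (intro cSup_least) auto
    then show ?thesis using x(2) by (simp add: field_simps)
  qed
  have lower: "k \<le> q * \<phi> x" if x: "x \<in> carrier A" "q > 0" "\<iota> q \<otimes> x \<ominus> \<iota> k \<in> M" for x k q
  proof -
    obtain j where j: "\<iota> (j + 1) \<ominus> x \<in> M" using bracket x(1) by blast
    then have "bdd_above (L x)"
      using L_bound[OF x(1), of 1 "j + 1"] x(1) by (intro bdd_aboveI) simp
    then have "real_of_int k / real_of_int q \<le> \<phi> x"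
      unfolding \<phi>_def using x by (intro cSup_upper) (auto simp: L_def)
    then show ?thesis using x(2) by (simp add: field_simps)
  qed
  have approx: "\<exists>k. \<iota> q \<otimes> x \<ominus> \<iota> k \<in> M \<and> \<iota> (k + 1) \<ominus> \<iota> q \<otimes> x \<in> M \<and> k \<le> q * \<phi> x \<and> q * \<phi> x \<le> k + 1"
    if xq: "x \<in> carrier A" "q > 0" for x and q :: int
  proof -
    obtain k where k: "\<iota> q \<otimes> x \<ominus> \<iota> k \<in> M" "\<iota> (k + 1) \<ominus> \<iota> q \<otimes> x \<in> M"
      using bracket[of "\<iota> q \<otimes> x"] xq(1) by auto
    then show ?thesis using lower[OF xq k(1)] upper[OF xq k(2)] by auto
  qed

  have add: "\<phi> (x \<oplus> y) = \<phi> x + \<phi> y" if x: "x \<in> carrier A" and y: "y \<in> carrier A" for x y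
  proof (rule real_eqI_of_bounded_multiples[where C = 2])
    fix q :: int assume q: "q > 0"
    obtain k where k: "\<iota> q \<otimes> x \<ominus> \<iota> k \<in> M" "\<iota> (k + 1) \<ominus> \<iota> q \<otimes> x \<in> M"
      "k \<le> q * \<phi> x" "q * \<phi> x \<le> k + 1" using approx[OF x q] by blast
    obtain l where l: "\<iota> q \<otimes> y \<ominus> \<iota> l \<in> M" "\<iota> (l + 1) \<ominus> \<iota> q \<otimes> y \<in> M"
      "l \<le> q * \<phi> y" "q * \<phi> y \<le> l + 1" using approx[OF y q] by blast
    note c = x y iota_closed[of q] iota_closed[of k] iota_closed[of l]
    have "\<iota> q \<otimes> (x \<oplus> y) \<ominus> \<iota> (k + l) = (\<iota> q \<otimes> x \<ominus> \<iota> k) \<oplus> (\<iota> q \<otimes> y \<ominus> \<iota> l)"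
      unfolding iota_add using c by algebra
    then have "k + l \<le> q * \<phi> (x \<oplus> y)"
      using lower[of "x \<oplus> y" q "k + l"] k(1) l(1) MD(3) x y q by simp
    moreover have "\<iota> ((k + 1) + (l + 1)) \<ominus> \<iota> q \<otimes> (x \<oplus> y)
        = (\<iota> (k + 1) \<ominus> \<iota> q \<otimes> x) \<oplus> (\<iota> (l + 1) \<ominus> \<iota> q \<otimes> y)"
      unfolding iota_add iota_1 using c by algebra
    then have "q * \<phi> (x \<oplus> y) \<le> (k + 1) + (l + 1)"
      using upper[of "x \<oplus> y" q "(k + 1) + (l + 1)"] k(2) l(2) MD(3) x y q by simp
    ultimately show "\<bar>q * \<phi> (x \<oplus> y) - q * (\<phi> x + \<phi> y)\<bar> \<le> 2"
      using k l by (simp add: distrib_left)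
  qed
  have nonneg: "\<phi> x \<ge> 0" if "x \<in> M" for x
    using lower[of x 1 0] that MD(1) by (simp add: a_minus_def)
  have zero: "\<phi> \<zero> = 0" using add[of \<zero> \<zero>] by simp
  have neg: "\<phi> (\<ominus> x) = - \<phi> x" if "x \<in> carrier A" for x
    using add[of x "\<ominus> x"] that zero by (simp add: r_neg)
  have diff: "\<phi> (x \<ominus> y) = \<phi> x - \<phi> y" if "x \<in> carrier A" "y \<in> carrier A" for x y
    using that by (simp add: a_minus_def add neg)
  have scale_nonneg: "\<phi> (\<iota> k \<otimes> x) = k * \<phi> x" if "0 \<le> k" "x \<in> carrier A" for k x
    using that
    by (induction k rule: int_ge_induct) (simp_all add: zero iota_add l_distr add distrib_right)
  have scale: "\<phi> (\<iota> k \<otimes> x) = k * \<phi> x" if "x \<in> carrier A" for k x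
    using scale_nonneg[of k x] scale_nonneg[of "- k" x] neg[of "\<iota> k \<otimes> x"] that
    by (cases "0 \<le> k") (auto simp: iota_minus l_minus)
  have one: "\<phi> \<one> = 1"
    using lower[of \<one> 1 1] upper[of \<one> 1 1] MD(2)[OF T_zero] by (simp add: a_minus_def r_neg)
  have mult_T: "\<phi> (x \<otimes> t) = \<phi> x * \<phi> t" if x: "x \<in> carrier A" and t: "t \<in> T" for x t
  proof (rule real_eqI_of_bounded_multiples[where C = "\<phi> t"])
    fix q :: int assume q: "q > 0"
    obtain k where k: "\<iota> q \<otimes> x \<ominus> \<iota> k \<in> M" "\<iota> (k + 1) \<ominus> \<iota> q \<otimes> x \<in> M"
      "k \<le> q * \<phi> x" "q * \<phi> x \<le> k + 1" using approx[OF x q] by blast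
    note c = x T_closed[OF t] iota_closed
    have t0: "\<phi> t \<ge> 0" using t MD(2) nonneg by blast
    have "t \<otimes> (\<iota> q \<otimes> x \<ominus> \<iota> k) = \<iota> q \<otimes> (x \<otimes> t) \<ominus> \<iota> k \<otimes> t"
      using x T_closed[OF t] iota_closed[of q] iota_closed[of k] by algebra
    then have "\<phi> (\<iota> q \<otimes> (x \<otimes> t) \<ominus> \<iota> k \<otimes> t) \<ge> 0"
      using nonneg[OF MD(4)[OF t k(1)]] by simp
    then have 1: "k * \<phi> t \<le> q * \<phi> (x \<otimes> t)"
      using c by (simp add: diff scale)
    have "t \<otimes> (\<iota> (k + 1) \<ominus> \<iota> q \<otimes> x) = \<iota> (k + 1) \<otimes> t \<ominus> \<iota> q \<otimes> (x \<otimes> t)"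
      using x T_closed[OF t] iota_closed[of q] iota_closed[of "k + 1"] by algebra
    then have "\<phi> (\<iota> (k + 1) \<otimes> t \<ominus> \<iota> q \<otimes> (x \<otimes> t)) \<ge> 0"
      using nonneg[OF MD(4)[OF t k(2)]] by simp
    then have 2: "q * \<phi> (x \<otimes> t) \<le> (k + 1) * \<phi> t"
      using c by (simp add: diff scale)
    have "k * \<phi> t \<le> q * \<phi> x * \<phi> t" "q * \<phi> x * \<phi> t \<le> (k + 1) * \<phi> t"
      using k(3,4) t0 by (auto intro: mult_right_mono)
    with 1 2 show "\<bar>q * \<phi> (x \<otimes> t) - q * (\<phi> x * \<phi> t)\<bar> \<le> \<phi> t"
      by (simp add: distrib_right mult.assoc abs_le_iff)
  qed
  have mult: "\<phi> (x \<otimes> y) = \<phi> x * \<phi> y" if x: "x \<in> carrier A" and y: "y \<in> carrier A" for x y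
  proof -
    obtain n where n: "\<iota> n \<oplus> y \<in> T" using obtain_integer_bound[OF y] .
    have "x \<otimes> y = x \<otimes> (\<iota> n \<oplus> y) \<ominus> \<iota> n \<otimes> x"
      using x y iota_closed[of n] by algebra
    moreover have "\<phi> (\<iota> n \<oplus> y) = n + \<phi> y"
      using add[of "\<iota> n" y] scale[of \<one> n] one y by simp
    ultimately show ?thesis
      using x y mult_T[OF x n] by (simp add: diff scale distrib_left)
  qed
  have "\<phi> \<in> real_homs A T"
    using add mult one nonneg MD(2) by (simp add: real_homs_iff)
  then show ?thesis using nonneg by blast
qed

text \<open>
  Every chain of modules omitting \<open>- 1\<close> has its union as an upper bound, so the given module
  lies in a maximal one, to which the two preceding lemmas apply.
\<close>

theorem T_module_separation:
  assumes M: "T_module M" and proper: "\<ominus> \<one> \<notin> M"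
  shows "\<exists>\<phi>\<in>real_homs A T. \<forall>x\<in>M. \<phi> x \<ge> 0"
proof -
  let ?\<N> = "{N. T_module N \<and> \<ominus> \<one> \<notin> N \<and> M \<subseteq> N}"
  have "\<exists>N\<in>?\<N>. \<forall>N'\<in>?\<N>. N \<subseteq> N' \<longrightarrow> N' = N"
  proof (rule subset_Zorn_nonempty)
    show "?\<N> \<noteq> {}" using assms by blast
    fix \<C> assume ne: "\<C> \<noteq> {}" and chain: "subset.chain ?\<N> \<C>"
    then have mods: "T_module N" "\<ominus> \<one> \<notin> N" "M \<subseteq> N" if "N \<in> \<C>" for N
      using that by (auto simp: subset.chain_def)
    have "x \<oplus> y \<in> \<Union> \<C>" if xy: "x \<in> \<Union> \<C>" "y \<in> \<Union> \<C>" for x y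
    proof -
      obtain N where "N \<in> \<C>" "x \<in> N" "y \<in> N"
        using xy chain unfolding subset.chain_def by blast
      then show ?thesis using mods(1) T_moduleD(3) by blast
    qed
    moreover have "T \<subseteq> \<Union> \<C>"
      using ne mods(1) unfolding T_module_def by blast
    moreover have "\<Union> \<C> \<subseteq> carrier A" "\<forall>t\<in>T. \<forall>x\<in>\<Union> \<C>. t \<otimes> x \<in> \<Union> \<C>"
      using mods(1) T_moduleD(1,4) by blast+
    ultimately have "T_module (\<Union> \<C>)"
      unfolding T_module_def by blast
    then show "\<Union> \<C> \<in> ?\<N>" using ne mods by blast
  qed
  then obtain N where "N \<in> ?\<N>" and max: "\<forall>N'\<in>?\<N>. N \<subseteq> N' \<longrightarrow> N' = N"
    by (rule bexE)
  then have N: "T_module N" "\<ominus> \<one> \<notin> N" "M \<subseteq> N" by auto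
  have "N' = N" if "T_module N'" "\<ominus> \<one> \<notin> N'" "N \<subseteq> N'" for N'
    using max that N(3) by simp
  from maximal_T_module_total[OF N(1,2) this]
  have "x \<in> N \<or> \<ominus> x \<in> N" if "x \<in> carrier A" for x
    using that by simp
  from total_T_module_hom[OF N(1,2) this] show ?thesis
    using N(3) by blast
qed

end

section \<open>Weak divisibility and descent\<close>

locale weakly_divisible_archimedean_semiring = archimedean_semiring +
  fixes r :: int
  assumes r_ge: "2 \<le> r"
    and r_unit: "\<iota> r \<in> Units A"
    and r_inv: "inv (\<iota> r) \<in> T"
begin

lemma power_r_pos: "0 < r ^ k"
  using r_ge by simp

lemma divide_power_r: "\<iota> (r ^ k) \<otimes> x \<in> T \<Longrightarrow> x \<in> carrier A \<Longrightarrow> x \<in> T"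
proof (induction k)
  case (Suc k)
  let ?y = "\<iota> (r ^ k) \<otimes> x"
  have "inv (\<iota> r) \<otimes> (\<iota> (r ^ Suc k) \<otimes> x) = (inv (\<iota> r) \<otimes> \<iota> r) \<otimes> ?y"
    using Suc.prems r_unit by (simp add: iota_mult m_assoc del: Units_l_inv)
  also have "\<dots> = ?y"
    using Suc.prems r_unit by simp
  finally have "?y \<in> T"
    using T_mult[OF r_inv Suc.prems(1)] by simp
  then show ?case using Suc by blast
qed simp

lemma obtain_power_r_bound:
  assumes "x \<in> carrier A"
  obtains k where "\<iota> (r ^ k) \<ominus> x \<in> T"
proof -
  obtain n where n: "0 \<le> n" "\<iota> n \<oplus> \<ominus> x \<in> T"
    using obtain_integer_bound[of "\<ominus> x"] assms by auto
  have "n < 2 ^ nat n"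
    using of_nat_less_two_power[of "nat n", where 'a = int] n(1) by simp
  also have "\<dots> \<le> r ^ nat n"
    using r_ge by (simp add: power_mono)
  finally have "\<iota> (r ^ nat n - n) \<oplus> (\<iota> n \<oplus> \<ominus> x) \<in> T"
    by (intro T_add[OF T_iota n(2)]) simp
  moreover have "\<iota> (r ^ nat n - n) \<oplus> (\<iota> n \<oplus> \<ominus> x) = \<iota> (r ^ nat n) \<ominus> x"
    unfolding iota_diff using assms iota_closed[of n] iota_closed[of "r ^ nat n"] by algebra
  ultimately show thesis using that by simp
qed

text \<open>
  With \<open>K \<ge> s\<close> a power of \<open>r\<close>, one coefficient is lowered at a time: if \<open>K b + i u \<in> T\<close> and
  \<open>i \<ge> 0\<close>, then
  \<open>(K - s) (K b + i u) + K (b s - u) + i s u = K (K b + (i - 1) u)\<close> lies in \<open>T\<close>, and \<open>K\<close> cancels.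
  The step is available for \<open>i = 0\<close> too, so the descent from \<open>i = K d\<close> ends at \<open>i = - 1\<close>.
\<close>

lemma descent:
  assumes b: "b \<in> carrier A" and s: "s \<in> T" and u: "u \<in> T"
    and bs: "b \<otimes> s \<ominus> u \<in> T"
    and d: "\<iota> d \<otimes> u \<oplus> b \<in> T" "0 \<le> d"
  shows "\<exists>k. \<iota> (r ^ k) \<otimes> b \<ominus> u \<in> T"
proof -
  note c = b T_closed[OF s] T_closed[OF u]
  obtain k where k: "\<iota> (r ^ k) \<ominus> s \<in> T"
    using obtain_power_r_bound[OF T_closed[OF s]] .
  let ?K = "\<iota> (r ^ k)"
  have K: "?K \<in> T" using power_r_pos[of k] by (intro T_iota) simp
  have step: "?K \<otimes> b \<oplus> \<iota> (i - 1) \<otimes> u \<in> T"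
    if i: "?K \<otimes> b \<oplus> \<iota> i \<otimes> u \<in> T" "0 \<le> i" for i
  proof (rule divide_power_r)
    have "(?K \<ominus> s) \<otimes> (?K \<otimes> b \<oplus> \<iota> i \<otimes> u) \<oplus> ?K \<otimes> (b \<otimes> s \<ominus> u) \<oplus> \<iota> i \<otimes> (s \<otimes> u) \<in> T"
      using T_add[OF T_add[OF T_mult[OF k i(1)] T_mult[OF K bs]] T_mult[OF T_iota[OF i(2)] T_mult[OF s u]]] .
    also have "(?K \<ominus> s) \<otimes> (?K \<otimes> b \<oplus> \<iota> i \<otimes> u) \<oplus> ?K \<otimes> (b \<otimes> s \<ominus> u) \<oplus> \<iota> i \<otimes> (s \<otimes> u)
        = ?K \<otimes> (?K \<otimes> b \<oplus> \<iota> (i - 1) \<otimes> u)"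
      unfolding iota_diff iota_1 using c iota_closed[of i] iota_closed[of "r ^ k"] by algebra
    finally show "?K \<otimes> (?K \<otimes> b \<oplus> \<iota> (i - 1) \<otimes> u) \<in> T" .
  qed (use c in simp)
  have down: "?K \<otimes> b \<oplus> \<iota> (- 1) \<otimes> u \<in> T" if "?K \<otimes> b \<oplus> \<iota> (int n) \<otimes> u \<in> T" for n
    using that
  proof (induction n)
    case 0
    then show ?case using step[of 0] by simp
  next
    case (Suc n)
    then show ?case using step[of "int (Suc n)"] by simp
  qed
  have "?K \<otimes> (\<iota> d \<otimes> u \<oplus> b) \<in> T" using K d by (intro T_mult)
  also have "?K \<otimes> (\<iota> d \<otimes> u \<oplus> b) = ?K \<otimes> b \<oplus> \<iota> (int (nat (r ^ k * d))) \<otimes> u"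
    using c d(2) power_r_pos[of k] by (simp add: iota_mult r_distr a_comm m_assoc)
  finally have "?K \<otimes> b \<oplus> \<iota> (- 1) \<otimes> u \<in> T" by (rule down)
  then show ?thesis using c by (auto simp: iota_minus l_minus a_minus_def)
qed

lemma descent_one:
  assumes b: "b \<in> carrier A" and s: "s \<in> T" and bs: "b \<otimes> s \<ominus> \<one> \<in> T"
  shows "\<exists>k. \<iota> (r ^ k) \<otimes> b \<ominus> \<one> \<in> T"
proof -
  obtain d where "0 \<le> d" "\<iota> d \<oplus> b \<in> T" using obtain_integer_bound[OF b] .
  then show ?thesis using descent[OF b s T_one bs, of d] by simp
qed

lemma mem_of_scaled_diff:
  assumes "x \<in> carrier A" "u \<in> T" "\<iota> (r ^ k) \<otimes> x \<ominus> u \<in> T"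
  shows "x \<in> T"
proof (rule divide_power_r)
  have "(\<iota> (r ^ k) \<otimes> x \<ominus> u) \<oplus> u \<in> T" using assms T_add by blast
  also have "(\<iota> (r ^ k) \<otimes> x \<ominus> u) \<oplus> u = \<iota> (r ^ k) \<otimes> x"
    using assms(1) T_closed[OF assms(2)] iota_closed[of "r ^ k"] by algebra
  finally show "\<iota> (r ^ k) \<otimes> x \<in> T" .
qed (use assms in simp)

lemma scaled_diff_mono:
  assumes x: "x \<in> carrier A" and u: "u \<in> T" and "\<iota> (r ^ k) \<otimes> x \<ominus> u \<in> T"
  shows "\<iota> (r ^ (l + k)) \<otimes> x \<ominus> u \<in> T"
proof -
  have "\<iota> (r ^ l) \<otimes> (\<iota> (r ^ k) \<otimes> x \<ominus> u) \<oplus> \<iota> (r ^ l - 1) \<otimes> u \<in> T"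
    using assms power_r_pos[of l] by (intro T_add T_mult T_iota) auto
  also have "\<iota> (r ^ l) \<otimes> (\<iota> (r ^ k) \<otimes> x \<ominus> u) \<oplus> \<iota> (r ^ l - 1) \<otimes> u = \<iota> (r ^ (l + k)) \<otimes> x \<ominus> u"
    unfolding power_add iota_mult iota_diff iota_1
    using x T_closed[OF u] iota_closed[of "r ^ k"] iota_closed[of "r ^ l"] by algebra
  finally show ?thesis .
qed

section \<open>Strict positivity\<close>

text \<open>
  If \<open>- 1\<close> were not in \<open>T - b T\<close>, a separating homomorphism would be nonpositive at \<open>b\<close>.
  Hence \<open>b s = 1 + t\<close> with \<open>s, t \<in> T\<close>, and descent applies.
\<close>

theorem positive_imp_mem:
  assumes b: "b \<in> carrier A" and pos: "\<And>\<phi>. \<phi> \<in> real_homs A T \<Longrightarrow> \<phi> b > 0"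
  shows "b \<in> T"
proof -
  let ?M = "{t \<oplus> s \<otimes> (\<ominus> b) | t s. t \<in> T \<and> s \<in> T}"
  have T: "T_module T"
    unfolding T_module_def using T_closed T_add T_mult by blast
  have nb: "\<ominus> b \<in> carrier A" using b by simp
  have "\<ominus> \<one> \<in> ?M"
  proof (rule ccontr)
    assume "\<not> ?thesis"
    then obtain \<phi> where \<phi>: "\<phi> \<in> real_homs A T" and "\<forall>x\<in>?M. \<phi> x \<ge> 0"
      using T_module_separation[OF T_module_adjoin(1)[OF T nb]] by blast
    then have "\<phi> (\<ominus> b) \<ge> 0" using T_module_adjoin(3)[OF T nb] by blast
    then show False using pos[OF \<phi>] hom_rules(2)[OF \<phi> b] by simp
  qed
  then obtain t s where ts: "t \<in> T" "s \<in> T" and eq: "\<ominus> \<one> = t \<oplus> s \<otimes> (\<ominus> b)" by blast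
  have "b \<otimes> s \<ominus> \<one> = b \<otimes> s \<oplus> (t \<oplus> s \<otimes> (\<ominus> b))"
    unfolding eq[symmetric] by (simp add: a_minus_def)
  also have "\<dots> = t" using b T_closed[OF ts(1)] T_closed[OF ts(2)] by algebra
  finally have "b \<otimes> s \<ominus> \<one> \<in> T" using ts(1) by simp
  then obtain k where "\<iota> (r ^ k) \<otimes> b \<ominus> \<one> \<in> T"
    using descent_one[OF b ts(2)] by blast
  then show ?thesis by (rule mem_of_scaled_diff[OF b T_one])
qed

text \<open>
  A homomorphism with \<open>\<phi>(b + n a) \<le> 0\<close> for all \<open>n \<ge> 0\<close> would satisfy \<open>\<phi>(a) \<le> 0\<close>, hence
  \<open>\<phi>(a) = 0\<close> as \<open>a\<close> is nonnegative on \<open>S(T)\<close>, and \<open>\<phi>(b) \<le> 0\<close>, which is excluded. So the module generated by \<open>T\<close> and all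
  \<open>- (b + n a)\<close> contains \<open>- 1\<close>. It is enclosed in the module \<open>M\<close> of all \<open>t - (b s + a s')\<close> with
  \<open>s' \<le> n s\<close> for some \<open>n\<close>, which avoids finite sums and still yields a single \<open>n\<close>.

  From \<open>- 1 \<in> M\<close> one gets \<open>(b + n a) s - a w \<ge> 1\<close> with \<open>w = n s - s' \<in> T\<close>. The error term is
  harmless because \<open>a\<close> is nonnegative on \<open>S(T)\<close>: the strict case gives \<open>a \<ge> - 1 / (2 N)\<close> for
  every power \<open>N\<close> of \<open>r\<close>, so that \<open>a w \<ge> - 1 / 2\<close> as soon as \<open>w \<le> N\<close>. Thus
  \<open>(b + n a) (2 s) \<ge> 1\<close>, and descent removes the factor \<open>2 s\<close>.
\<close>

lemma positive_after_adding_multiple: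
  assumes a: "a \<in> carrier A" and b: "b \<in> carrier A"
    and nonneg: "\<And>\<phi>. \<phi> \<in> real_homs A T \<Longrightarrow> \<phi> a \<ge> 0"
    and pos: "\<And>\<phi>. \<phi> \<in> real_homs_zero A T a \<Longrightarrow> \<phi> b > 0"
  shows "\<exists>n\<ge>0. \<exists>k. \<iota> (r ^ k) \<otimes> (b \<oplus> \<iota> n \<otimes> a) \<ominus> \<one> \<in> T"
proof -
  let ?f = "\<lambda>t s s'. t \<ominus> (b \<otimes> s \<oplus> a \<otimes> s')"
  define M where "M = {?f t s s' | t s s'. t \<in> T \<and> s \<in> T \<and> s' \<in> T \<and> (\<exists>n\<ge>0. \<iota> n \<otimes> s \<ominus> s' \<in> T)}"
  have M: "T_module M"
    unfolding T_module_def
  proof (intro conjI ballI subsetI)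
    fix t assume t: "t \<in> T"
    have "t = ?f t \<zero> \<zero>" using t T_closed a b by (simp add: a_minus_def)
    moreover have "\<iota> 0 \<otimes> \<zero> \<ominus> \<zero> \<in> T" by (simp add: a_minus_def)
    ultimately show "t \<in> M" unfolding M_def using t T_zero by blast
  next
    fix x assume "x \<in> M"
    then show "x \<in> carrier A" unfolding M_def using a b T_closed by auto
  next
    fix x y assume "x \<in> M" "y \<in> M"
    then obtain t s s' n u v v' l where
      x: "t \<in> T" "s \<in> T" "s' \<in> T" "0 \<le> n" "\<iota> n \<otimes> s \<ominus> s' \<in> T" "x = ?f t s s'" and
      y: "u \<in> T" "v \<in> T" "v' \<in> T" "0 \<le> l" "\<iota> l \<otimes> v \<ominus> v' \<in> T" "y = ?f u v v'"
      unfolding M_def by blast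
    note c = a b x(1-3)[THEN T_closed] y(1-3)[THEN T_closed] iota_closed[of n] iota_closed[of l]
    have xy: "x \<oplus> y = ?f (t \<oplus> u) (s \<oplus> v) (s' \<oplus> v')"
      unfolding x(6) y(6) using c by algebra
    have "(\<iota> n \<otimes> s \<ominus> s') \<oplus> (\<iota> l \<otimes> v \<ominus> v') \<oplus> \<iota> n \<otimes> v \<oplus> \<iota> l \<otimes> s \<in> T"
      using x y by (intro T_add T_mult T_iota)
    also have "(\<iota> n \<otimes> s \<ominus> s') \<oplus> (\<iota> l \<otimes> v \<ominus> v') \<oplus> \<iota> n \<otimes> v \<oplus> \<iota> l \<otimes> s
        = \<iota> (n + l) \<otimes> (s \<oplus> v) \<ominus> (s' \<oplus> v')"
      unfolding iota_add using c by algebra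
    finally have "\<exists>n\<ge>0. \<iota> n \<otimes> (s \<oplus> v) \<ominus> (s' \<oplus> v') \<in> T"
      using x(4) y(4) add_nonneg_nonneg by blast
    moreover have "t \<oplus> u \<in> T" "s \<oplus> v \<in> T" "s' \<oplus> v' \<in> T" using x y T_add by auto
    ultimately show "x \<oplus> y \<in> M" unfolding M_def xy by blast
  next
    fix u x assume u: "u \<in> T" and "x \<in> M"
    then obtain t s s' n where
      x: "t \<in> T" "s \<in> T" "s' \<in> T" "0 \<le> n" "\<iota> n \<otimes> s \<ominus> s' \<in> T" "x = ?f t s s'"
      unfolding M_def by blast
    note c = a b x(1-3)[THEN T_closed] T_closed[OF u] iota_closed[of n]
    have ux: "u \<otimes> x = ?f (u \<otimes> t) (u \<otimes> s) (u \<otimes> s')"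
      unfolding x(6) using c by algebra
    have "u \<otimes> (\<iota> n \<otimes> s \<ominus> s') \<in> T" using u x T_mult by blast
    also have "u \<otimes> (\<iota> n \<otimes> s \<ominus> s') = \<iota> n \<otimes> (u \<otimes> s) \<ominus> u \<otimes> s'" using c by algebra
    finally have "\<exists>n\<ge>0. \<iota> n \<otimes> (u \<otimes> s) \<ominus> u \<otimes> s' \<in> T" using x(4) by blast
    moreover have "u \<otimes> t \<in> T" "u \<otimes> s \<in> T" "u \<otimes> s' \<in> T" using u x T_mult by auto
    ultimately show "u \<otimes> x \<in> M" unfolding M_def ux by blast
  qed
  have "\<ominus> \<one> \<in> M"
  proof (rule ccontr)
    assume "\<ominus> \<one> \<notin> M"
    from T_module_separation[OF M this] obtain \<phi>
      where \<phi>: "\<phi> \<in> real_homs A T" and M_nonneg: "\<forall>x\<in>M. \<phi> x \<ge> 0" by blast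
    have bound: "\<phi> b + real n * \<phi> a \<le> 0" for n
    proof -
      have "\<iota> (int n) \<otimes> \<one> \<ominus> \<iota> (int n) \<in> T" by (simp add: a_minus_def r_neg)
      then have "?f \<zero> \<one> (\<iota> (int n)) \<in> M"
        unfolding M_def using T_zero T_one T_iota[of "int n"] of_nat_0_le_iff by blast
      also have "?f \<zero> \<one> (\<iota> (int n)) = \<ominus> (b \<oplus> a \<otimes> \<iota> (int n))"
        using a b iota_closed[of "int n"] by algebra
      finally have "\<phi> (\<ominus> (b \<oplus> a \<otimes> \<iota> (int n))) \<ge> 0" using M_nonneg by blast
      then show ?thesis using a b by (simp add: hom_rules[OF \<phi>] mult.commute)
    qed
    have "\<phi> a = 0"
    proof (rule ccontr)
      assume "\<phi> a \<noteq> 0"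
      then have "\<phi> a > 0" using nonneg[OF \<phi>] by simp
      then obtain n where "- \<phi> b < real n * \<phi> a" using reals_Archimedean3 by blast
      then show False using bound[of n] by simp
    qed
    then have "\<phi> b > 0" using pos \<phi> by (simp add: real_homs_zero_def)
    then show False using bound[of 0] by simp
  qed
  then obtain t s s' n where ts: "t \<in> T" "s \<in> T" "s' \<in> T" and n: "0 \<le> n" "\<iota> n \<otimes> s \<ominus> s' \<in> T"
    and eq: "\<ominus> \<one> = ?f t s s'"
    unfolding M_def by blast
  let ?c = "b \<oplus> \<iota> n \<otimes> a" and ?w = "\<iota> n \<otimes> s \<ominus> s'"
  note c = a b ts[THEN T_closed] iota_closed[of n]
  have "?c \<otimes> s \<ominus> a \<otimes> ?w \<ominus> \<one> = ?c \<otimes> s \<ominus> a \<otimes> ?w \<oplus> ?f t s s'"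
    unfolding eq[symmetric] by (simp add: a_minus_def)
  also have "\<dots> = t" using c by algebra
  finally have 1: "?c \<otimes> s \<ominus> a \<otimes> ?w \<ominus> \<one> \<in> T" using ts(1) by simp
  obtain j where j: "\<iota> (r ^ j) \<ominus> ?w \<in> T"
    using obtain_power_r_bound[OF T_closed[OF n(2)]] .
  let ?N = "\<iota> (r ^ j)"
  have N: "?N \<in> T" using power_r_pos[of j] by (intro T_iota) simp
  have two: "\<iota> 2 \<in> T" by (rule T_iota) simp
  have small: "\<iota> 2 \<otimes> ?N \<otimes> a \<oplus> \<one> \<in> T"
  proof (rule positive_imp_mem)
    fix \<phi> assume \<phi>: "\<phi> \<in> real_homs A T"
    have "0 \<le> real_of_int r ^ j * \<phi> a"
      using nonneg[OF \<phi>] r_ge by (intro mult_nonneg_nonneg) auto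
    then show "0 < \<phi> (\<iota> 2 \<otimes> ?N \<otimes> a \<oplus> \<one>)" using a by (simp add: hom_rules[OF \<phi>] mult.assoc)
  qed (use a in simp)
  have \<iota>2: "\<iota> 2 = \<one> \<oplus> \<one>" using iota_add[of 1 1] by simp
  have C: "?c \<in> carrier A" and W: "?w \<in> carrier A" using c by simp_all
  \<comment> \<open>Stated for variables because normalizing the identity with \<open>b + n a\<close> and \<open>n s - s'\<close>
    multiplied out is far more expensive.\<close>
  have identity: "(\<one> \<oplus> \<one>) \<otimes> N \<otimes> (x \<otimes> s \<ominus> a \<otimes> w \<ominus> \<one>) \<oplus> w \<otimes> ((\<one> \<oplus> \<one>) \<otimes> N \<otimes> a \<oplus> \<one>) \<oplus> (N \<ominus> w)
      = N \<otimes> (x \<otimes> ((\<one> \<oplus> \<one>) \<otimes> s) \<ominus> \<one>)"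
    if "x \<in> carrier A" "w \<in> carrier A" "a \<in> carrier A" "s \<in> carrier A" "N \<in> carrier A" for x w a s N
    using that by algebra
  have "?c \<otimes> (\<iota> 2 \<otimes> s) \<ominus> \<one> \<in> T"
  proof (rule divide_power_r)
    have "\<iota> 2 \<otimes> ?N \<otimes> (?c \<otimes> s \<ominus> a \<otimes> ?w \<ominus> \<one>) \<oplus> ?w \<otimes> (\<iota> 2 \<otimes> ?N \<otimes> a \<oplus> \<one>) \<oplus> (?N \<ominus> ?w) \<in> T"
      using T_add[OF T_add[OF T_mult[OF T_mult[OF two N] 1] T_mult[OF n(2) small]] j] .
    also have "\<iota> 2 \<otimes> ?N \<otimes> (?c \<otimes> s \<ominus> a \<otimes> ?w \<ominus> \<one>) \<oplus> ?w \<otimes> (\<iota> 2 \<otimes> ?N \<otimes> a \<oplus> \<one>) \<oplus> (?N \<ominus> ?w)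
        = ?N \<otimes> (?c \<otimes> ((\<one> \<oplus> \<one>) \<otimes> s) \<ominus> \<one>)"
      using C W a T_closed[OF ts(2)] unfolding \<iota>2 by (rule identity) simp
    also have "\<one> \<oplus> \<one> = \<iota> 2" using \<iota>2 ..
    finally show "?N \<otimes> (?c \<otimes> (\<iota> 2 \<otimes> s) \<ominus> \<one>) \<in> T" .
  qed (use c in simp)
  moreover have "?c \<in> carrier A" "\<iota> 2 \<otimes> s \<in> T" using c ts T_mult T_iota[of 2] by auto
  ultimately show ?thesis using descent_one n(1) by blast
qed

section \<open>Nonnegativity with zeros\<close>

text \<open>
  Multiplying \<open>r\<^sup>k (b\<^sub>i + n\<^sub>i a) \<ge> 1\<close> by \<open>t\<^sub>i\<close> and adding up bounds \<open>S = \<Sum> b\<^sub>i t\<^sub>i\<close>, up to a multiple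
  of \<open>a\<close>, from below by \<open>u = \<Sum> t\<^sub>i\<close>; the integers \<open>n\<^sub>i\<close> may differ, being absorbed in the
  coefficient \<open>v\<close> of \<open>a\<close>, but the power of \<open>r\<close> has to be common. The element \<open>a\<close> is kept independent
  of \<open>S\<close> to permit induction on the index set.
\<close>

lemma sum_estimates:
  assumes a: "a \<in> carrier A" and fin: "finite I"
    and b: "\<And>i. i \<in> I \<Longrightarrow> b i \<in> carrier A" and t: "\<And>i. i \<in> I \<Longrightarrow> t i \<in> T"
    and pos: "\<And>i. i \<in> I \<Longrightarrow> \<exists>n\<ge>0. \<exists>k. \<iota> (r ^ k) \<otimes> (b i \<oplus> \<iota> n \<otimes> a) \<ominus> \<one> \<in> T"
  defines "u \<equiv> \<lambda>I. \<Oplus>i\<in>I. t i" and "S \<equiv> \<lambda>I. \<Oplus>i\<in>I. b i \<otimes> t i"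
  shows "u I \<in> T \<and> S I \<in> carrier A \<and>
    (\<exists>k. \<exists>v\<in>T. \<iota> (r ^ k) \<otimes> S I \<oplus> a \<otimes> v \<ominus> u I \<in> T) \<and> (\<exists>d\<ge>0. \<iota> d \<otimes> u I \<oplus> S I \<in> T)"
  using fin b t pos
proof (induction I rule: finite_induct)
  case empty
  have "\<iota> (r ^ 0) \<otimes> \<zero> \<oplus> a \<otimes> \<zero> \<ominus> \<zero> \<in> T" "\<iota> 0 \<otimes> \<zero> \<oplus> \<zero> \<in> T"
    using a by (simp_all add: a_minus_def)
  then show ?case unfolding u_def S_def using T_zero by fastforce
next
  case (insert i I)
  have bi: "b i \<in> carrier A" and ti: "t i \<in> T" using insert.prems by auto
  have IH: "u I \<in> T" "S I \<in> carrier A"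
    "\<exists>k. \<exists>v\<in>T. \<iota> (r ^ k) \<otimes> S I \<oplus> a \<otimes> v \<ominus> u I \<in> T" "\<exists>d\<ge>0. \<iota> d \<otimes> u I \<oplus> S I \<in> T"
    using insert.IH insert.prems by auto
  obtain k v where v: "v \<in> T" and k: "\<iota> (r ^ k) \<otimes> S I \<oplus> a \<otimes> v \<ominus> u I \<in> T" using IH(3) by blast
  obtain d where d: "0 \<le> d" "\<iota> d \<otimes> u I \<oplus> S I \<in> T" using IH(4) by blast
  obtain n l where n: "0 \<le> n" and l: "\<iota> (r ^ l) \<otimes> (b i \<oplus> \<iota> n \<otimes> a) \<ominus> \<one> \<in> T"
    using insert.prems(3)[of i] by blast
  obtain e where e: "0 \<le> e" "\<iota> e \<oplus> b i \<in> T" using obtain_integer_bound[OF bi] .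
  have "t i \<in> carrier A" "t \<in> I \<rightarrow> carrier A" "(\<lambda>i. b i \<otimes> t i) \<in> I \<rightarrow> carrier A"
    using insert.prems T_closed by auto
  then have u_ins: "u (insert i I) = t i \<oplus> u I" and S_ins: "S (insert i I) = b i \<otimes> t i \<oplus> S I"
    unfolding u_def S_def using insert.hyps bi by simp_all
  note c = a bi T_closed[OF ti] T_closed[OF IH(1)] IH(2) T_closed[OF v] iota_closed[of n]
    iota_closed[of "r ^ k"] iota_closed[of "r ^ l"] iota_closed[of d] iota_closed[of e]
  have kl: "\<iota> (r ^ (k + l)) \<otimes> (b i \<oplus> \<iota> n \<otimes> a) \<ominus> \<one> \<in> T"
    using scaled_diff_mono[OF _ T_one l] bi a by simp
  let ?v = "\<iota> (r ^ l) \<otimes> v \<oplus> \<iota> (r ^ (k + l)) \<otimes> \<iota> n \<otimes> t i"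
  have "\<iota> (r ^ l) \<otimes> (\<iota> (r ^ k) \<otimes> S I \<oplus> a \<otimes> v \<ominus> u I) \<oplus> \<iota> (r ^ l - 1) \<otimes> u I
      \<oplus> (\<iota> (r ^ (k + l)) \<otimes> (b i \<oplus> \<iota> n \<otimes> a) \<ominus> \<one>) \<otimes> t i \<in> T"
    using k kl ti IH(1) power_r_pos[of l] by (intro T_add T_mult T_iota) auto
  also have "\<iota> (r ^ l) \<otimes> (\<iota> (r ^ k) \<otimes> S I \<oplus> a \<otimes> v \<ominus> u I) \<oplus> \<iota> (r ^ l - 1) \<otimes> u I
      \<oplus> (\<iota> (r ^ (k + l)) \<otimes> (b i \<oplus> \<iota> n \<otimes> a) \<ominus> \<one>) \<otimes> t i
      = \<iota> (r ^ (k + l)) \<otimes> S (insert i I) \<oplus> a \<otimes> ?v \<ominus> u (insert i I)"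
    unfolding u_ins S_ins power_add iota_mult iota_diff iota_1 using c by algebra
  finally have 1: "\<iota> (r ^ (k + l)) \<otimes> S (insert i I) \<oplus> a \<otimes> ?v \<ominus> u (insert i I) \<in> T" .
  have v': "?v \<in> T"
    using v ti n power_r_pos[of l] power_r_pos[of "k + l"] by (intro T_add T_mult T_iota) auto
  have "(\<iota> d \<otimes> u I \<oplus> S I) \<oplus> (\<iota> e \<oplus> b i) \<otimes> t i \<oplus> \<iota> d \<otimes> t i \<oplus> \<iota> e \<otimes> u I \<in> T"
    using T_add[OF T_add[OF T_add[OF d(2) T_mult[OF e(2) ti]] T_mult[OF T_iota[OF d(1)] ti]]
        T_mult[OF T_iota[OF e(1)] IH(1)]] .
  also have "(\<iota> d \<otimes> u I \<oplus> S I) \<oplus> (\<iota> e \<oplus> b i) \<otimes> t i \<oplus> \<iota> d \<otimes> t i \<oplus> \<iota> e \<otimes> u I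
      = \<iota> (d + e) \<otimes> u (insert i I) \<oplus> S (insert i I)"
    unfolding u_ins S_ins iota_add using c by algebra
  finally have "\<exists>d\<ge>0. \<iota> d \<otimes> u (insert i I) \<oplus> S (insert i I) \<in> T"
    using d(1) e(1) add_nonneg_nonneg by blast
  moreover have "u (insert i I) \<in> T" "S (insert i I) \<in> carrier A"
    unfolding u_ins S_ins using ti IH(1) T_add c by auto
  ultimately show ?case using 1 v' by blast
qed

end

theorem theorem10:
  fixes A :: "('a, 'm) ring_scheme" and T :: "'a set" and a :: 'a
    and m :: nat and b t :: "nat \<Rightarrow> 'a"
  assumes "cring A"
    and "semiring_of A T"
    and "weakly_divisible A T"
    and "archimedean A T"
    and "a \<in> carrier A"
    and "\<And>\<phi>. \<phi> \<in> real_homs A T \<Longrightarrow> \<phi> a \<ge> 0"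
    and "\<And>i. i \<in> {1..m} \<Longrightarrow> b i \<in> carrier A"
    and "\<And>i. i \<in> {1..m} \<Longrightarrow> t i \<in> T"
    and "a = (\<Oplus>\<^bsub>A\<^esub>i\<in>{1..m}. b i \<otimes>\<^bsub>A\<^esub> t i)"
    and "\<And>\<phi> i. \<phi> \<in> real_homs_zero A T a \<Longrightarrow> i \<in> {1..m} \<Longrightarrow> \<phi> (b i) > 0"
  shows "a \<in> T"
proof -
  interpret archimedean_semiring A T
    using assms by (simp add: archimedean_semiring_def archimedean_semiring_axioms_def)
  obtain r :: int where "2 \<le> r" "\<iota> r \<in> Units A" "inv\<^bsub>A\<^esub> (\<iota> r) \<in> T"
    using assms(3) unfolding weakly_divisible_def \<iota>_def by blast
  then interpret weakly_divisible_archimedean_semiring A T r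
    by unfold_locales
  define u where "u = (\<Oplus>\<^bsub>A\<^esub>i\<in>{1..m}. t i)"
  have "\<exists>n\<ge>0. \<exists>k. \<iota> (r ^ k) \<otimes>\<^bsub>A\<^esub> (b i \<oplus>\<^bsub>A\<^esub> \<iota> n \<otimes>\<^bsub>A\<^esub> a) \<ominus>\<^bsub>A\<^esub> \<one>\<^bsub>A\<^esub> \<in> T" if "i \<in> {1..m}" for i
    by (rule positive_after_adding_multiple[OF assms(5) assms(7)[OF that]])
      (use assms(6,10) that in blast)+
  with sum_estimates[where a = a and I = "{1..m}" and b = b and t = t, folded assms(9) u_def] assms(5,7,8)
  have u: "u \<in> T" and "\<exists>k. \<exists>v\<in>T. \<iota> (r ^ k) \<otimes>\<^bsub>A\<^esub> a \<oplus>\<^bsub>A\<^esub> a \<otimes>\<^bsub>A\<^esub> v \<ominus>\<^bsub>A\<^esub> u \<in> T"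
    and "\<exists>d\<ge>0. \<iota> d \<otimes>\<^bsub>A\<^esub> u \<oplus>\<^bsub>A\<^esub> a \<in> T"
    by simp_all
  then obtain k v d where v: "v \<in> T" and k: "\<iota> (r ^ k) \<otimes>\<^bsub>A\<^esub> a \<oplus>\<^bsub>A\<^esub> a \<otimes>\<^bsub>A\<^esub> v \<ominus>\<^bsub>A\<^esub> u \<in> T"
    and d: "0 \<le> d" "\<iota> d \<otimes>\<^bsub>A\<^esub> u \<oplus>\<^bsub>A\<^esub> a \<in> T"
    by blast
  \<comment> \<open>As \<open>a\<close> is the sum itself, the two occurrences of \<open>a\<close> combine to \<open>a (r\<^sup>k + v) \<ge> u\<close>.\<close>
  have "\<iota> (r ^ k) \<oplus>\<^bsub>A\<^esub> v \<in> T"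
    using v power_r_pos[of k] by (intro T_add T_iota) auto
  moreover have "a \<otimes>\<^bsub>A\<^esub> (\<iota> (r ^ k) \<oplus>\<^bsub>A\<^esub> v) \<ominus>\<^bsub>A\<^esub> u \<in> T"
    using k assms(5) T_closed[OF v] by (simp add: r_distr m_comm)
  ultimately obtain l where "\<iota> (r ^ l) \<otimes>\<^bsub>A\<^esub> a \<ominus>\<^bsub>A\<^esub> u \<in> T"
    using descent[OF assms(5) _ u _ d(2,1)] by blast
  then show ?thesis
    by (rule mem_of_scaled_diff[OF assms(5) u])
qed

end
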